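(* Let $I\subseteq\mathbb{Z}_{>0}$ be a finite set, let $m=\max(I\cup\{0\})$, and let $d_I(z)$ be the descent polynomial of $I$. If $z_0$ is a complex number such that $d_I(z_0)=0$, then \begin{enumerate} \item $|z_0|\leq m$, and \item $\Re(z_0)\geq -1$. \end{enumerate}
   Context: $\mathfrak{S}_n$ is the set of permutations of $[n]=\{1,\ldots,n\}$. The descent set of $\pi=\pi_1\cdots\pi_n\in\mathfrak{S}_n$ is the set of positions $i\in[n-1]$ such that $\pi_i>\pi_{i+1}$. For a finite set $I$ of positive integers, the descent polynomial $d_I(z)$ is the unique polynomial such that, for every integer $n>\max(I\cup\{0\})$, $d_I(n)$ is the number of elements of $\mathfrak{S}_n$ whose descent set is exactly $I$ (such a polynomial is known to exist). Here $|z|$ and $\Re(z)$ denote the modulus and the real part of the complex number $z$. *)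

theory Defs
  imports Complex_Main "HOL-Combinatorics.Permutations"
    "HOL-Computational_Algebra.Polynomial"
begin

text \<open>A permutation of \<open>[n]\<close> is a function \<open>p\<close> on the naturals with \<open>p permutes {1..n}\<close>; such a
  function is the identity outside \<open>{1..n}\<close>, so distinct functions are distinct elements of
  \<open>\<SS>\<^sub>n\<close>.\<close>

definition descent_set :: "nat \<Rightarrow> (nat \<Rightarrow> nat) \<Rightarrow> nat set" where
  "descent_set n p = {i \<in> {1..<n}. p i > p (i + 1)}"

definition is_descent_poly :: "nat set \<Rightarrow> complex poly \<Rightarrow> bool" where
  "is_descent_poly I d \<longleftrightarrow>
     (\<forall>n. n > Max (I \<union> {0}) \<longrightarrow>
        poly d (of_nat n) = of_nat (card {p. p permutes {1..n} \<and> descent_set n p = I}))"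

text \<open>Meaningful for finite sets of positive integers, where such a polynomial exists; two such
  polynomials agree at infinitely many points and so are equal.\<close>

definition descent_poly :: "nat set \<Rightarrow> complex poly" where
  "descent_poly I = (THE d. is_descent_poly I d)"

end

theory Submission
  imports Defs "HOL-Library.Infinite_Set"
begin

text \<open>Let \<open>c\<^sub>0 < \<dots> < c\<^sub>k\<close> be the elements of \<open>{0, \<dots>, m - 1}\<close> that are not in \<open>I\<close>. The descent
  polynomial has the Newton form
  \<open>d\<^sub>I(z) = (\<Prod>i\<in>I. z - i) \<cdot> (\<Sum>j\<le>k. C\<^sub>j \<cdot> (\<Prod>i<j. z - c\<^sub>i))\<close> with all \<open>C\<^sub>j\<close> positive. Indeed, for \<open>b\<close> larger
  than all elements of \<open>I\<close>, counting the permutations whose behaviour at position \<open>b\<close> is left free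
  gives \<open>d\<^bsub>I \<union> {b}\<^esub>(z) = d\<^sub>I(b) \<cdot> binom(z, b) - d\<^sub>I(z)\<close>, and on the coefficients this is the recursion
  \<open>(b - c\<^sub>j) C'\<^sub>j = C'\<^bsub>j-1\<^esub> + C\<^sub>j\<close> (lemma \<open>newton_form_row_above\<close>). So \<open>C\<^sub>j\<close> is a sum over lattice paths of
  products of reciprocals \<open>1/(b - c)\<close>. The numbers \<open>b - c\<close> are the hook lengths of a Young diagram
  with a row for each \<open>b \<in> I\<close> and a column for each \<open>c\<close>, so this is the hook formula of Naruse for
  the number of standard fillings of a ribbon.

  For a real number \<open>a\<close> and \<open>Q(z) = (\<Sum>j\<le>k. C\<^sub>j \<cdot> (\<Prod>i<j. z - c\<^sub>i))\<close>,
  \<open>(z - a) Q(z) = C\<^sub>k (\<Prod>i\<le>k. z - c\<^sub>i) - (\<Sum>j\<le>k. D\<^sub>j (\<Prod>i<j. z - c\<^sub>i))\<close> with \<open>D\<^sub>j = (a - c\<^sub>j) C\<^sub>j - C\<^bsub>j-1\<^esub>\<close>.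
  If every \<open>D\<^sub>j\<close> is nonnegative and \<open>\<bar>z - c\<^sub>i\<bar> > q\<^sub>i\<close>, then the first term dominates as soon as it does so
  with each \<open>z - c\<^sub>i\<close> replaced by \<open>q\<^sub>i\<close> (lemma \<open>newton_form_nonzero\<close>). For \<open>\<bar>z\<bar> > m\<close> take \<open>a = m\<close> and
  \<open>q\<^sub>i = m - c\<^sub>i\<close>: the \<open>D\<^sub>j\<close> are the coefficients of the preceding set, and the comparison is an equality.

  For \<open>Re z < -1\<close> take \<open>q\<^sub>i = 1 + c\<^sub>i\<close> and \<open>a = c\<^sub>k + 1\<close>. With \<open>x\<^sub>j = C\<^sub>j (\<Prod>i<j. 1 + c\<^sub>i)\<close>, the modulus of the
  \<open>j\<close>-th summand of \<open>Q(-1)\<close>, the comparison becomes \<open>(\<Sum>j\<le>k. x\<^sub>j (2 c\<^sub>j - c\<^sub>k)) \<ge> 0\<close>: the weights \<open>x\<^sub>j\<close> lean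
  towards the large \<open>c\<^sub>j\<close>. This and \<open>D\<^sub>j \<ge> 0\<close> are proved by induction on the rows, with a stronger
  hypothesis (definition \<open>good_row\<close>). On the old columns, passing to the next row multiplies the \<open>x\<^sub>j\<close>
  by factors increasing in \<open>j\<close> (lemma \<open>row_ratio\<close>), which can only push weight to the right. On the
  columns that the next row has in addition, the \<open>x\<^sub>j\<close> have a closed form, and their moments
  telescope.\<close>

section \<open>Permutations with a free position and the recursion for descent polynomials\<close>

definition perm_count :: "nat \<Rightarrow> nat set \<Rightarrow> nat" where
  "perm_count n I = card {p. p permutes {1..n} \<and> descent_set n p = I}"

lemma increasing_bij_exists:
  fixes S :: "nat set"
  assumes "finite S"
  obtains h where "bij_betw h {a+1..a+card S} S" "strict_mono_on {a+1..a+card S} h"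
proof -
  obtain g where g: "bij_betw g {..<card S} S" "strict_mono_on {..<card S} g"
    using ex_bij_betw_strict_mono_card[OF assms] by blast
  have "bij_betw (\<lambda>i. i - (a+1)) {a+1..a+card S} {..<card S}"
    by (rule bij_betwI[where g = "\<lambda>i. i + (a+1)"]) auto
  then have 1: "bij_betw (g \<circ> (\<lambda>i. i - (a+1))) {a+1..a+card S} S"
    using g(1) bij_betw_trans by blast
  have 2: "strict_mono_on {a+1..a+card S} (g \<circ> (\<lambda>i. i - (a+1)))"
  proof (rule strict_mono_onI)
    fix r s assume rs: "r \<in> {a+1..a+card S}" "s \<in> {a+1..a+card S}" "r < s"
    then have "r - (a+1) \<in> {..<card S}" "s - (a+1) \<in> {..<card S}" "r - (a+1) < s - (a+1)" by auto
    then show "(g \<circ> (\<lambda>i. i - (a+1))) r < (g \<circ> (\<lambda>i. i - (a+1))) s"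
      using g(2) unfolding strict_mono_on_def by simp
  qed
  show thesis using that 1 2 by blast
qed

text \<open>A permutation whose only possible descent is at \<open>b\<close> is the same as its set of first \<open>b\<close> values.
  These permutations are the representatives used to split off the choice of that set.\<close>

lemma sorting_permutation_exists:
  assumes "S \<subseteq> {1..n}" "card S = b"
  shows "\<exists>s. s permutes {1..n} \<and> s ` {1..b} = S \<and>
           strict_mono_on {1..b} s \<and> strict_mono_on {b+1..n} s"
proof -
  have finS: "finite S" using assms(1) finite_subset by blast
  have bn: "b \<le> n" using card_mono[OF _ assms(1)] assms(2) by simp
  have cT: "card ({1..n} - S) = n - b" using assms finS by (simp add: card_Diff_subset)
  obtain h where h: "bij_betw h {1..b} S" "strict_mono_on {1..b} h"
    using increasing_bij_exists[OF finS, of 0] assms(2) by auto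
  have "finite ({1..n} - S)" by simp
  then obtain k where k: "bij_betw k {b+1..n} ({1..n} - S)" "strict_mono_on {b+1..n} k"
    using increasing_bij_exists[of "{1..n} - S" b] cT bn by auto
  define s where "s i = (if i \<in> {1..b} then h i else if i \<in> {b+1..n} then k i else i)" for i
  have sb: "bij_betw s {1..b} S"
    using h(1) by (rule bij_betw_cong[THEN iffD1, rotated]) (simp add: s_def)
  have st: "bij_betw s {b+1..n} ({1..n} - S)"
    using k(1) by (rule bij_betw_cong[THEN iffD1, rotated]) (simp add: s_def)
  have "bij_betw s ({1..b} \<union> {b+1..n}) (S \<union> ({1..n} - S))"
    using bij_betw_combine[OF sb st] by blast
  moreover have "{1..b} \<union> {b+1..n} = {1..n}" "S \<union> ({1..n} - S) = {1..n}"
    using bn assms(1) by auto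
  ultimately have "bij_betw s {1..n} {1..n}" by simp
  then have "s permutes {1..n}"
    by (rule bij_imp_permutes) (use bn in \<open>auto simp: s_def\<close>)
  moreover have "s ` {1..b} = S" using sb by (simp add: bij_betw_def)
  moreover have "strict_mono_on {1..b} s" using h(2) by (auto simp: strict_mono_on_def s_def)
  moreover have "strict_mono_on {b+1..n} s" using k(2) by (auto simp: strict_mono_on_def s_def)
  ultimately show ?thesis by blast
qed

lemma strict_mono_on_stepI:
  fixes f :: "nat \<Rightarrow> nat"
  assumes "\<And>i. \<lbrakk>a \<le> i; i < n\<rbrakk> \<Longrightarrow> f i < f (i + 1)"
  shows "strict_mono_on {a..n} f"
proof (rule strict_mono_onI)
  fix r s assume rs: "r \<in> {a..n}" "s \<in> {a..n}" "r < s"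
  from rs(3) rs show "f r < f s"
  proof (induction s)
    case (Suc s)
    show ?case
    proof (cases "r = s")
      case True
      then show ?thesis using assms[of s] Suc.prems by simp
    next
      case False
      then have "f r < f s" using Suc by simp
      moreover have "f s < f (s + 1)" using assms[of s] Suc.prems False by simp
      ultimately show ?thesis by simp
    qed
  qed simp
qed

lemma strict_mono_on_interval_id:
  fixes f :: "nat \<Rightarrow> nat"
  assumes "f ` {a+1..n} = {a+1..n}" "strict_mono_on {a+1..n} f" "i \<in> {a+1..n}"
  shows "f i = i"
proof -
  have ge: "i \<le> n \<longrightarrow> i \<le> f i" if "a + 1 \<le> i" for i
    using that
  proof (induction i rule: dec_induct)
    case base
    show ?case using assms(1) by (metis atLeastAtMost_iff image_eqI order_refl)
  next
    case (step k)
    show ?case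
    proof
      assume "Suc k \<le> n"
      then have "f k < f (Suc k)" using assms(2) step(1) by (auto simp: strict_mono_on_def)
      then show "Suc k \<le> f (Suc k)" using step.IH \<open>Suc k \<le> n\<close> by simp
    qed
  qed
  define g where "g i = (if i \<in> {a+1..n} then f i else i)" for i
  have "inj_on f {a+1..n}" using assms(2) by (rule strict_mono_on_imp_inj_on)
  then have "bij_betw f {a+1..n} {a+1..n}" using assms(1) by (simp add: bij_betw_def)
  then have "bij_betw g {a+1..n} {a+1..n}"
    by (rule bij_betw_cong[THEN iffD1, rotated]) (simp add: g_def)
  then have "g permutes {a+1..n}" by (rule bij_imp_permutes) (auto simp: g_def)
  then have "g = id" by (rule permutes_natset_ge) (use ge in \<open>auto simp: g_def\<close>)
  then show ?thesis using assms(3) by (metis g_def id_apply)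
qed

text \<open>On \<open>{1..b}\<close> the increasing map \<open>s\<close> preserves the order of the values of \<open>q\<close>, and beyond \<open>b\<close> the
  composite is the increasing map \<open>s\<close> itself; only position \<open>b\<close> is uncontrolled.\<close>

lemma descent_set_sorted_comp:
  assumes "b < n" "s permutes {1..n}" "strict_mono_on {1..b} s" "strict_mono_on {b+1..n} s"
    and "q permutes {1..b}"
  shows "descent_set n (s \<circ> q) - {b} = descent_set b q"
proof -
  have low: "s (q i) > s (q (i+1)) \<longleftrightarrow> q i > q (i+1)" if "i \<ge> 1" "i < b" for i
  proof -
    have "q i \<in> {1..b}" "q (i+1) \<in> {1..b}" using permutes_in_image[OF assms(5)] that by auto
    then show ?thesis using strict_mono_on_less[OF assms(3)] by blast
  qed
  have high: "\<not> s (q i) > s (q (i+1))" if "i > b" "i < n" for i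
  proof -
    have "q i = i" "q (i+1) = i+1" using permutes_not_in[OF assms(5)] that by auto
    moreover have "s i < s (i+1)" using assms(4) that by (auto simp: strict_mono_on_def)
    ultimately show ?thesis by simp
  qed
  have "i \<in> descent_set n (s \<circ> q) - {b} \<longleftrightarrow> i \<in> descent_set b q" for i
    using low[of i] high[of i] assms(1) unfolding descent_set_def
    by (cases "i < b"; cases "i = b") auto
  then show ?thesis by blast
qed

text \<open>A permutation that is counted here is, in exactly one way, \<open>s \<circ> q\<close> with \<open>q\<close> a permutation of \<open>{1..b}\<close> that
  carries the descents before \<open>b\<close>, and \<open>s\<close> determined by a choice of \<open>b\<close> values out of \<open>n\<close>: since it
  ascends after \<open>b\<close>, the order of its last \<open>n - b\<close> values is forced.\<close>

lemma card_free_position: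
  assumes "b < n" "I \<subseteq> {1..<b}"
  shows "card {p. p permutes {1..n} \<and> descent_set n p - {b} = I} = (n choose b) * perm_count b I"
proof -
  define S where "S = {S. S \<subseteq> {1..n} \<and> card S = b}"
  define Q where "Q = {q. q permutes {1..b} \<and> descent_set b q = I}"
  define A where "A = {p. p permutes {1..n} \<and> descent_set n p - {b} = I}"
  have "\<forall>X\<in>S. \<exists>s. s permutes {1..n} \<and> s ` {1..b} = X \<and>
           strict_mono_on {1..b} s \<and> strict_mono_on {b+1..n} s"
    using sorting_permutation_exists unfolding S_def by blast
  then obtain s where s: "\<And>X. X \<in> S \<Longrightarrow> s X permutes {1..n}"
      "\<And>X. X \<in> S \<Longrightarrow> s X ` {1..b} = X"
      "\<And>X. X \<in> S \<Longrightarrow> strict_mono_on {1..b} (s X)"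
      "\<And>X. X \<in> S \<Longrightarrow> strict_mono_on {b+1..n} (s X)"
    by metis
  have img: "(s X \<circ> q) ` {1..b} = X" if "X \<in> S" "q \<in> Q" for X q
  proof -
    have "q ` {1..b} = {1..b}" using that(2) permutes_image unfolding Q_def by blast
    then show ?thesis using s(2)[OF that(1)] by (metis image_comp)
  qed
  have "bij_betw (\<lambda>(X, q). s X \<circ> q) (S \<times> Q) A"
    unfolding bij_betw_def
  proof
    show "inj_on (\<lambda>(X, q). s X \<circ> q) (S \<times> Q)"
    proof (rule inj_onI, clarify)
      fix X q Y r
      assume a: "X \<in> S" "q \<in> Q" "Y \<in> S" "r \<in> Q" "s X \<circ> q = s Y \<circ> r"
      then have "X = Y" using img by metis
      moreover have "inj (s X)" using s(1)[OF a(1)] permutes_inj by blast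
      ultimately show "X = Y \<and> q = r" using a(5) by (simp add: fun_eq_iff inj_eq)
    qed
    show "(\<lambda>(X, q). s X \<circ> q) ` (S \<times> Q) = A"
    proof
      show "(\<lambda>(X, q). s X \<circ> q) ` (S \<times> Q) \<subseteq> A"
      proof clarify
        fix X q assume a: "X \<in> S" "q \<in> Q"
        have q: "q permutes {1..b}" "descent_set b q = I" using a(2) unfolding Q_def by auto
        have "q permutes {1..n}" using q(1) by (rule permutes_subset) (use assms(1) in auto)
        then have "s X \<circ> q permutes {1..n}" using s(1)[OF a(1)] by (rule permutes_compose)
        moreover have "descent_set n (s X \<circ> q) - {b} = I"
          using descent_set_sorted_comp[OF assms(1) s(1,3,4)[OF a(1)] q(1)] q(2) by simp
        ultimately show "s X \<circ> q \<in> A" unfolding A_def by simp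
      qed
      show "A \<subseteq> (\<lambda>(X, q). s X \<circ> q) ` (S \<times> Q)"
      proof
        fix p assume "p \<in> A"
        then have p: "p permutes {1..n}" "descent_set n p - {b} = I" unfolding A_def by auto
        have injp: "inj p" using p(1) permutes_inj by blast
        define X where "X = p ` {1..b}"
        have "X \<subseteq> {1..n}" using permutes_image[OF p(1)] assms(1) unfolding X_def by fastforce
        moreover have "card X = b" unfolding X_def using injp by (simp add: card_image inj_on_subset)
        ultimately have XS: "X \<in> S" unfolding S_def by simp
        define q where "q = inv (s X) \<circ> p"
        have sq: "s X \<circ> q = p" unfolding q_def using permutes_surj[OF s(1)[OF XS]]
          by (simp add: fun_eq_iff surj_f_inv_f)
        have qn: "q permutes {1..n}" unfolding q_def
          using p(1) permutes_inv[OF s(1)[OF XS]] by (rule permutes_compose)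
        have injs: "inj (s X)" using s(1)[OF XS] permutes_inj by blast
        \<comment> \<open>Sorting the first \<open>b\<close> values away leaves a permutation of \<open>{1..b}\<close> and an increasing one of the rest.\<close>
        have "q ` {1..b} = {1..b}"
        proof -
          have "s X ` (q ` {1..b}) = s X ` {1..b}"
            using s(2)[OF XS] sq X_def by (metis image_comp)
          then show ?thesis using injs by (simp add: inj_image_eq_iff)
        qed
        moreover have "q ` {1..n} = {1..n}" using qn by (rule permutes_image)
        moreover have "{b+1..n} = {1..n} - {1..b}" using assms(1) by auto
        moreover have "q ` ({1..n} - {1..b}) = q ` {1..n} - q ` {1..b}"
          using permutes_inj[OF qn] by (rule image_set_diff)
        ultimately have qh: "q ` {b+1..n} = {b+1..n}" by simp
        have pm: "strict_mono_on {b+1..n} p"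
        proof (rule strict_mono_on_stepI)
          fix i assume i: "b + 1 \<le> i" "i < n"
          have "i \<notin> descent_set n p" using p(2) assms(2) i by fastforce
          then have "p i \<le> p (i+1)" using i unfolding descent_set_def by auto
          moreover have "p i \<noteq> p (i+1)" using injp by (simp add: inj_eq)
          ultimately show "p i < p (i+1)" by simp
        qed
        have qm: "strict_mono_on {b+1..n} q"
        proof (rule strict_mono_onI)
          fix i j assume ij: "i \<in> {b+1..n}" "j \<in> {b+1..n}" "i < j"
          have "s X (q i) < s X (q j)"
            using pm ij sq unfolding strict_mono_on_def by (metis comp_apply)
          moreover have "q i \<in> {b+1..n}" "q j \<in> {b+1..n}" using ij qh by blast+
          ultimately show "q i < q j" using strict_mono_on_less[OF s(4)[OF XS]] by blast
        qed
        have "q i = i" if "i \<in> {1..n} - {1..b}" for i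
          using strict_mono_on_interval_id[OF qh qm, of i] that by auto
        then have qb: "q permutes {1..b}" by (intro permutes_superset[OF qn]) auto
        have "descent_set b q = I"
          using descent_set_sorted_comp[OF assms(1) s(1,3,4)[OF XS] qb] sq p(2) by simp
        then have "q \<in> Q" using qb unfolding Q_def by simp
        then show "p \<in> (\<lambda>(X, q). s X \<circ> q) ` (S \<times> Q)" using XS sq by force
      qed
    qed
  qed
  then have "card A = card (S \<times> Q)" by (metis bij_betw_same_card)
  also have "\<dots> = (n choose b) * card Q"
    unfolding card_cartesian_product S_def by (simp add: n_subsets)
  finally show ?thesis unfolding A_def Q_def perm_count_def by simp
qed

lemma perm_count_insert_Max:
  assumes "b < n" "I \<subseteq> {1..<b}" "0 < b"
  shows "perm_count n (insert b I) + perm_count n I = (n choose b) * perm_count b I"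
proof -
  have fin: "finite {p. p permutes {1..n} \<and> P p}" for P
    using finite_permutations[of "{1..n}"] by (rule rev_finite_subset) auto
  have bI: "b \<notin> I" using assms(2) by auto
  have "{p. p permutes {1..n} \<and> descent_set n p - {b} = I} =
     {p. p permutes {1..n} \<and> descent_set n p = insert b I} \<union> {p. p permutes {1..n} \<and> descent_set n p = I}"
    using bI by blast
  moreover have "{p. p permutes {1..n} \<and> descent_set n p = insert b I} \<inter>
      {p. p permutes {1..n} \<and> descent_set n p = I} = {}" using bI by blast
  ultimately show ?thesis
    using card_free_position[OF assms(1,2)] fin unfolding perm_count_def
    by (simp add: card_Un_disjoint)
qed

text \<open>The product divided by \<open>fact b\<close> is the polynomial \<open>binom(z, b)\<close>, and \<open>d(b)\<close> is the number of
  permutations of \<open>{1..b}\<close> with descent set \<open>I\<close>.\<close>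

lemma is_descent_poly_insert:
  assumes "finite I" "\<forall>i\<in>I. 0 < i" "\<forall>i\<in>I. i < b" "0 < b" "is_descent_poly I d"
  shows "is_descent_poly (insert b I)
     (smult (poly d (of_nat b) / fact b) (\<Prod>i<b. [:- of_nat i, 1:]) - d)"
  unfolding is_descent_poly_def
proof (intro allI impI)
  fix n assume n: "Max (insert b I \<union> {0}) < n"
  then have bn: "b < n" using assms(1) by simp
  have I: "I \<subseteq> {1..<b}" using assms(2,3) by force
  have "Max (I \<union> {0}) < b" using assms by simp
  then have db: "poly d (of_nat b) = of_nat (perm_count b I)"
    and dn: "poly d (of_nat n) = of_nat (perm_count n I)"
    using assms(5) bn unfolding is_descent_poly_def perm_count_def by auto
  have binom: "(\<Prod>i<b. of_nat n - of_nat i :: complex) / fact b = of_nat (n choose b)"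
    by (simp add: binomial_gbinomial gbinomial_prod_rev atLeast0LessThan)
  have "of_nat (perm_count n (insert b I)) = (of_nat (perm_count n (insert b I) + perm_count n I) :: complex)
      - of_nat (perm_count n I)" by simp
  also have "\<dots> = of_nat (n choose b) * of_nat (perm_count b I) - of_nat (perm_count n I)"
    using perm_count_insert_Max[OF bn I assms(4)] by simp
  also have "\<dots> = poly (smult (poly d (of_nat b) / fact b) (\<Prod>i<b. [:- of_nat i, 1:]) - d) (of_nat n)"
    by (simp add: db dn poly_prod binom[symmetric])
  finally show "poly (smult (poly d (of_nat b) / fact b) (\<Prod>i<b. [:- of_nat i, 1:]) - d) (of_nat n)
     = of_nat (card {p. p permutes {1..n} \<and> descent_set n p = insert b I})"
    unfolding perm_count_def by simp
qed

lemma is_descent_poly_empty: "is_descent_poly {} 1"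
  unfolding is_descent_poly_def
proof (intro allI impI)
  fix n :: nat assume "Max ({} \<union> {0}) < n"
  have "{p. p permutes {1..n} \<and> descent_set n p = {}} = {id}"
  proof
    show "{p. p permutes {1..n} \<and> descent_set n p = {}} \<subseteq> {id}"
    proof clarify
      fix p assume p: "p permutes {1..n}" "descent_set n p = {}"
      have "strict_mono_on {0+1..n} p"
      proof (rule strict_mono_on_stepI)
        fix i assume "0 + 1 \<le> i" "i < n"
        then have "p i \<le> p (i+1)" using p(2) unfolding descent_set_def by auto
        moreover have "p i \<noteq> p (i+1)" using permutes_inj[OF p(1)] by (simp add: inj_eq)
        ultimately show "p i < p (i+1)" by simp
      qed
      then have "p i = i" if "i \<in> {1..n}" for i
        using strict_mono_on_interval_id[of p 0 n i] permutes_image[OF p(1)] that by simp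
      then show "p = id" using permutes_not_in[OF p(1)] by fastforce
    qed
  qed (auto simp: descent_set_def permutes_id)
  then show "poly 1 (of_nat n) = (of_nat (card {p. p permutes {1..n} \<and> descent_set n p = {}}) :: complex)"
    by simp
qed

text \<open>Two candidates agree at infinitely many integers.\<close>

lemma descent_poly_eqI:
  assumes "is_descent_poly I d"
  shows "descent_poly I = d"
  unfolding descent_poly_def
proof (rule the_equality, rule assms)
  fix e assume e: "is_descent_poly I e"
  have "poly (e - d) (of_nat n) = 0" if "n > Max (I \<union> {0})" for n
    using assms e that unfolding is_descent_poly_def by simp
  then have "of_nat ` {Max (I \<union> {0})<..} \<subseteq> {z. poly (e - d) z = 0}" by auto
  moreover have "infinite (of_nat ` {Max (I \<union> {0})<..} :: complex set)"
    by (simp add: finite_image_iff inj_on_def infinite_Ioi)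
  ultimately have "infinite {z. poly (e - d) z = 0}" using finite_subset by blast
  then have "e - d = 0" using poly_roots_finite by blast
  then show "e = d" by simp
qed

section \<open>Rows of Newton coefficients\<close>

text \<open>The recursion of the Newton coefficients from the row \<open>e\<close> to the row of the new element \<open>b\<close>. The
  coefficient of column \<open>j\<close> has index \<open>j + 1\<close>, so that the entry \<open>0\<close> at index \<open>0\<close> serves as the
  coefficient to the left of the first column. The row \<open>e\<close> below is indexed by the column itself.\<close>

primrec row_above :: "nat \<Rightarrow> (nat \<Rightarrow> nat) \<Rightarrow> (nat \<Rightarrow> real) \<Rightarrow> nat \<Rightarrow> real" where
  "row_above b c e 0 = 0"
| "row_above b c e (Suc j) = (row_above b c e j + e j) / (real b - real (c j))"

text \<open>For the row of \<open>b\<close> this recovers the row below; for other \<open>a\<close> in place of \<open>b\<close> these are the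
  coefficients \<open>D\<^sub>j\<close> that arise from multiplying a Newton form by \<open>z - a\<close>.\<close>

definition defect :: "nat \<Rightarrow> (nat \<Rightarrow> nat) \<Rightarrow> (nat \<Rightarrow> real) \<Rightarrow> nat \<Rightarrow> real" where
  "defect b c C j = (real b - real (c j)) * C (Suc j) - C j"

definition basis_at_minus_one :: "(nat \<Rightarrow> nat) \<Rightarrow> nat \<Rightarrow> real" where
  "basis_at_minus_one c j = (\<Prod>i<j. 1 + real (c i))"

definition term_at_minus_one :: "(nat \<Rightarrow> nat) \<Rightarrow> (nat \<Rightarrow> real) \<Rightarrow> nat \<Rightarrow> real" where
  "term_at_minus_one c C j = C (Suc j) * basis_at_minus_one c j"

text \<open>The induction hypothesis on the row of \<open>b\<close>, whose columns are \<open>c 0, \<dots>, c k\<close>. Write \<open>s\<^sub>j\<close> for the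
  quotient of \<open>defect b c C j\<close> by \<open>C (Suc j)\<close>, the coefficient of column \<open>j\<close> in the row below relative to
  this row. That \<open>s\<^sub>j\<close> decreases in \<open>j\<close> is what makes the passage to the next row push weight to the
  right. The lower bound on \<open>s\<^sub>j\<close> says that the \<open>defect\<close> with \<open>c k + 1\<close> in place of \<open>b\<close> is nonnegative.
  The last conjunct is the inequality behind the bound on the real part; the one before it, that the
  last weight is the largest, controls how much weight flows into new columns.\<close>

definition good_row :: "nat \<Rightarrow> nat \<Rightarrow> (nat \<Rightarrow> nat) \<Rightarrow> (nat \<Rightarrow> real) \<Rightarrow> bool" where
  "good_row b k c C \<longleftrightarrow>
     strict_mono_on {..k} c \<and> c k < b \<and> C 0 = 0 \<and> (\<forall>j\<le>k. 0 < C (Suc j)) \<and>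
     (\<forall>j<k. defect b c C (Suc j) / C (Suc (Suc j)) \<le> defect b c C j / C (Suc j)) \<and>
     (\<forall>j\<le>k. real b - 1 - real (c k) \<le> defect b c C j / C (Suc j)) \<and>
     (\<forall>j\<le>k. term_at_minus_one c C j \<le> term_at_minus_one c C k) \<and>
     0 \<le> (\<Sum>j\<le>k. term_at_minus_one c C j * (2 * real (c j) - real (c k)))"

lemma basis_at_minus_one_pos: "0 < basis_at_minus_one c j"
  unfolding basis_at_minus_one_def by (intro prod_pos) (simp add: add_pos_nonneg)

lemma basis_at_minus_one_Suc: "basis_at_minus_one c (Suc j) = basis_at_minus_one c j * (1 + real (c j))"
  unfolding basis_at_minus_one_def by simp

lemma defect_row_above:
  assumes "c j < b"
  shows "defect b c (row_above b c e) j = e j"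
  using assms by (simp add: defect_def)

lemma term_at_minus_one_step:
  assumes "defect b c C (Suc j) = 0"
  shows "(real b - real (c (Suc j))) * term_at_minus_one c C (Suc j) = (1 + real (c j)) * term_at_minus_one c C j"
proof -
  have "(real b - real (c (Suc j))) * term_at_minus_one c C (Suc j) =
      ((real b - real (c (Suc j))) * C (Suc (Suc j))) * basis_at_minus_one c (Suc j)"
    unfolding term_at_minus_one_def by (simp only: mult.assoc)
  also have "\<dots> = C (Suc j) * (basis_at_minus_one c j * (1 + real (c j)))"
    using assms unfolding defect_def by (simp add: basis_at_minus_one_Suc)
  finally show ?thesis unfolding term_at_minus_one_def by (simp only: ac_simps)
qed

lemma row_above_pos:
  assumes "\<And>i. i \<le> j \<Longrightarrow> c i < b" "\<And>i. i \<le> j \<Longrightarrow> 0 \<le> e i" "0 < e 0"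
  shows "0 < row_above b c e (Suc j)"
  using assms
proof (induction j)
  case (Suc j)
  then have "0 < row_above b c e (Suc j)" by simp
  then show ?case using Suc.prems(1)[of "Suc j"] Suc.prems(2)[of "Suc j"]
    by (auto simp del: row_above.simps simp: row_above.simps(2)[of b c e "Suc j"] intro!: divide_pos_pos add_pos_nonneg)
qed auto

section \<open>Comparison of consecutive rows\<close>

text \<open>Write \<open>\<delta> = b' - b\<close>, \<open>s\<^sub>j = defect b c C j / C (Suc j)\<close> and \<open>\<rho>\<^sub>j = C j / C (Suc j)\<close>. Since
  \<open>b' - c j = \<delta> + s\<^sub>j + \<rho>\<^sub>j\<close>, the recursion for the ratios \<open>r\<^sub>j\<close> of the new row to the old one reads
  \<open>r\<^sub>j (\<delta> + s\<^sub>j + \<rho>\<^sub>j) = 1 + \<rho>\<^sub>j r\<^bsub>j-1\<^esub>\<close>: the ratio \<open>r\<^sub>j\<close> is a weighted mean of \<open>r\<^bsub>j-1\<^esub>\<close> and \<open>1/(\<delta> + s\<^sub>j)\<close>.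
  The latter increases with \<open>j\<close>, so by induction \<open>r\<^bsub>j-1\<^esub> \<le> r\<^sub>j \<le> 1/(\<delta> + s\<^sub>j)\<close>.\<close>

lemma row_ratio:
  assumes good: "good_row b k c C" and bb: "b < b'"
    and e: "\<And>j. j \<le> k \<Longrightarrow> e j = C (Suc j)"
  defines "r \<equiv> \<lambda>j. row_above b' c e (Suc j) / C (Suc j)"
  shows "j \<le> k \<Longrightarrow> 0 < r j \<and> r j * (real b' - real b + defect b c C j / C (Suc j)) \<le> 1"
    and "j < k \<Longrightarrow> r j \<le> r (Suc j)"
proof -
  let ?d = "real b' - real b"
  define s where "s j = defect b c C j / C (Suc j)" for j
  have Cp: "0 < C (Suc j)" if "j \<le> k" for j using good that unfolding good_row_def by blast
  have cb: "c j < b" if "j \<le> k" for j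
  proof -
    have "c j \<le> c k" using good that unfolding good_row_def strict_mono_on_def
      by (metis atMost_iff le_neq_implies_less less_imp_le order_refl)
    then show ?thesis using good unfolding good_row_def by simp
  qed
  have d: "1 \<le> ?d" using bb by simp
  have s0: "0 \<le> s j" if "j \<le> k" for j
  proof -
    have "real b - 1 - real (c k) \<le> s j" using good that unfolding good_row_def s_def by blast
    moreover have "0 \<le> real b - 1 - real (c k)" using good unfolding good_row_def by simp
    ultimately show ?thesis by linarith
  qed
  have sm: "s (Suc j) \<le> s j" if "j < k" for j using good that unfolding good_row_def s_def by blast
  have rpos: "0 < r j" if "j \<le> k" for j
    unfolding r_def using Cp[of j] that
    by (intro divide_pos_pos row_above_pos) (use that e Cp cb bb in \<open>auto intro: less_imp_le intro!: less_trans[OF cb bb]\<close>)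
  have C0: "C 0 = 0" using good unfolding good_row_def by blast
  define q where "q j = C j / C (Suc j)" for j
  have hook: "real b' - real (c j) = ?d + s j + q j" if "j \<le> k" for j
    using Cp[OF that] unfolding s_def q_def defect_def by (simp add: field_simps)
  have rec0: "r 0 * (?d + s 0) = 1"
    using hook[of 0] Cp[of 0] C0 e[of 0] cb[of 0] bb unfolding r_def q_def by (simp add: field_simps)
  have q0: "0 \<le> q (Suc j)" if "j < k" for j using Cp[of j] Cp[of "Suc j"] that unfolding q_def by simp
  have recS: "r (Suc j) * (?d + s (Suc j) + q (Suc j)) = 1 + q (Suc j) * r j" if "j < k" for j
  proof -
    have "real b' - real (c (Suc j)) > 0" using cb[of "Suc j"] bb that by simp
    then have "r (Suc j) * (real b' - real (c (Suc j))) =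
        (row_above b' c e (Suc j) + e (Suc j)) / C (Suc (Suc j))"
      unfolding r_def by (subst row_above.simps) simp
    also have "\<dots> = q (Suc j) * r j + 1"
      using Cp[of "Suc j"] Cp[of j] e[of "Suc j"] that unfolding q_def r_def
      by (simp add: add_divide_distrib del: row_above.simps)
    finally show ?thesis using hook[of "Suc j"] that by simp
  qed
  have main: "r j * (?d + s j) \<le> 1" if "j \<le> k" for j
    using that
  proof (induction j)
    case 0 show ?case using rec0 by simp
  next
    case (Suc j)
    have j: "j < k" using Suc.prems by simp
    have IH: "r j * (?d + s j) \<le> 1" using Suc by simp
    have "r j * (?d + s (Suc j)) \<le> r j * (?d + s j)" using rpos[of j] sm[OF j] j by simp
    then have "r j * (?d + s (Suc j) + q (Suc j)) \<le> r (Suc j) * (?d + s (Suc j) + q (Suc j))"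
      using recS[OF j] IH by (simp add: algebra_simps)
    moreover have pos: "0 < ?d + s (Suc j) + q (Suc j)" using d s0[of "Suc j"] q0[OF j] j by simp
    ultimately have "r j \<le> r (Suc j)" by simp
    then have "q (Suc j) * r j \<le> q (Suc j) * r (Suc j)" using q0[OF j] by (rule mult_left_mono)
    then show ?case using recS[OF j] by (simp add: algebra_simps)
  qed
  show "j \<le> k \<Longrightarrow> 0 < r j \<and> r j * (?d + defect b c C j / C (Suc j)) \<le> 1"
    using rpos main unfolding s_def by blast
  show "r j \<le> r (Suc j)" if j: "j < k"
  proof -
    have "r j * (?d + s (Suc j)) \<le> r j * (?d + s j)" using rpos[of j] sm[OF j] j by simp
    then have "r j * (?d + s (Suc j) + q (Suc j)) \<le> r (Suc j) * (?d + s (Suc j) + q (Suc j))"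
      using recS[OF j] main[of j] j by (simp add: algebra_simps)
    moreover have pos: "0 < ?d + s (Suc j) + q (Suc j)" using d s0[of "Suc j"] q0[OF j] j by simp
    ultimately show ?thesis by simp
  qed
qed

text \<open>A Chebyshev type inequality: the increasing \<open>f\<close> changes sign once, and replacing each \<open>r j\<close> by the
  value of \<open>r\<close> at the sign change can only decrease the sum.\<close>

lemma sum_increasing_factor_nonneg:
  fixes r x f :: "nat \<Rightarrow> real"
  assumes "\<And>j. j \<le> k \<Longrightarrow> 0 \<le> r j" "\<And>j. j \<le> k \<Longrightarrow> 0 \<le> x j"
    and "\<And>i j. \<lbrakk>i \<le> j; j \<le> k\<rbrakk> \<Longrightarrow> r i \<le> r j" "\<And>i j. \<lbrakk>i \<le> j; j \<le> k\<rbrakk> \<Longrightarrow> f i \<le> f j"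
    and "0 \<le> (\<Sum>j\<le>k. x j * f j)"
  shows "0 \<le> (\<Sum>j\<le>k. r j * (x j * f j))"
proof -
  have "\<exists>t\<ge>0. \<forall>j\<le>k. t * (x j * f j) \<le> r j * (x j * f j)"
  proof (cases "\<exists>j\<le>k. 0 < f j")
    case True
    define l where "l = (LEAST j. j \<le> k \<and> 0 < f j)"
    have l: "l \<le> k" "0 < f l" using LeastI_ex[OF True] unfolding l_def by auto
    \<comment> \<open>\<open>l\<close> is where the increasing \<open>f\<close> becomes positive.\<close>
    have "r l * (x j * f j) \<le> r j * (x j * f j)" if j: "j \<le> k" for j
    proof (cases "j < l")
      case True
      then have "f j \<le> 0" using not_less_Least[of j "\<lambda>j. j \<le> k \<and> 0 < f j"] j unfolding l_def by force
      then have "x j * f j \<le> 0" using assms(2)[OF j] by (simp add: mult_nonneg_nonpos)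
      then show ?thesis using assms(3)[of j l] True l by (simp add: mult_right_mono_neg)
    next
      case False
      then have "0 \<le> f j" using assms(4)[of l j] l j by simp
      then have "0 \<le> x j * f j" using assms(2)[OF j] by simp
      then show ?thesis using assms(3)[of l j] False j by (simp add: mult_right_mono)
    qed
    then show ?thesis using assms(1)[OF l(1)] by blast
  next
    case False
    have "r k * (x j * f j) \<le> r j * (x j * f j)" if j: "j \<le> k" for j
    proof -
      have "x j * f j \<le> 0" using assms(2)[OF j] False j by (meson mult_nonneg_nonpos not_less)
      then show ?thesis using assms(3)[of j k] j by (simp add: mult_right_mono_neg)
    qed
    then show ?thesis using assms(1)[of k] by blast
  qed
  then obtain t where t: "t \<ge> 0" "\<And>j. j \<le> k \<Longrightarrow> t * (x j * f j) \<le> r j * (x j * f j)" by blast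
  have "0 \<le> t * (\<Sum>j\<le>k. x j * f j)" using t(1) assms(5) by simp
  also have "\<dots> = (\<Sum>j\<le>k. t * (x j * f j))" by (rule sum_distrib_left)
  also have "\<dots> \<le> (\<Sum>j\<le>k. r j * (x j * f j))" by (rule sum_mono) (use t(2) in simp)
  finally show ?thesis .
qed

section \<open>Columns without a predecessor in the row below\<close>

text \<open>The columns \<open>beta, \<dots>, beta + n - 1\<close> that appear in the row of \<open>b = beta + n\<close> but not in the row below
  receive weight only from their left neighbours; \<open>Y\<close> is the weight flowing in from the old columns.
  For the first row, \<open>beta = 0\<close> and \<open>Y = 1\<close>.\<close>

lemma fresh_columns_closed_form:
  fixes x :: "nat \<Rightarrow> real"
  assumes "0 < n" "real n * x 0 = Y"
    and "\<And>i. Suc i < n \<Longrightarrow> (real n - real (Suc i)) * x (Suc i) = (real beta + real i + 1) * x i"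
    and "i < n"
  shows "x i * (fact beta * fact n) = Y * (fact (beta + i) * fact (n - 1 - i))"
  using assms(4)
proof (induction i)
  case 0
  have "fact n = real n * fact (n - 1)" using assms(1) by (simp add: fact_reduce)
  then show ?case using assms(2) by (simp add: algebra_simps)
next
  case (Suc i)
  define l where "l = n - 1 - Suc i"
  have l: "n - 1 - i = Suc l" "n = l + i + 2" using Suc.prems unfolding l_def by auto
  have "(real l + 1) * (x (Suc i) * (fact beta * fact n)) = (real n - real (Suc i)) * x (Suc i) * (fact beta * fact n)"
    using l(2) by simp
  also have "\<dots> = (real beta + real i + 1) * (x i * (fact beta * fact n))"
    using assms(3)[OF Suc.prems] by simp
  also have "\<dots> = (real beta + real i + 1) * (Y * (fact (beta + i) * fact (Suc l)))"
    using Suc l by simp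
  also have "\<dots> = (real l + 1) * (Y * (fact (beta + Suc i) * fact l))" by (simp add: algebra_simps)
  finally show ?case unfolding l_def[symmetric] by (simp add: add_nonneg_eq_0_iff)
qed

lemma fact_mult_le: "fact a * fact b \<le> (fact (a + b) :: real)"
  using fact_fact_dvd_fact[of a b, where 'a = nat] by (metis dvd_imp_le fact_gt_zero of_nat_fact of_nat_le_iff of_nat_mult)

text \<open>By the closed form, if \<open>Y > 0\<close>, the quotient \<open>x i / x (n - 1)\<close> is the reciprocal of a binomial coefficient.\<close>

lemma fresh_columns_le_last:
  fixes x :: "nat \<Rightarrow> real"
  assumes "0 < n" "real n * x 0 = Y" "0 \<le> Y"
    and "\<And>i. Suc i < n \<Longrightarrow> (real n - real (Suc i)) * x (Suc i) = (real beta + real i + 1) * x i"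
    and "i < n"
  shows "x i \<le> x (n - 1)"
proof -
  have le: "fact (beta + i) * fact (n - 1 - i) \<le> (fact (beta + (n - 1)) * fact (n - 1 - (n - 1)) :: real)"
    using fact_mult_le[of "beta + i" "n - 1 - i"] assms(5) by simp
  have "x i * (fact beta * fact n) \<le> x (n - 1) * (fact beta * fact n)"
    using fresh_columns_closed_form[OF assms(1,2,4)] assms(5)
      mult_left_mono[OF le assms(3)] by simp
  then show ?thesis by simp
qed

text \<open>For \<open>beta = 0\<close> the last weight is only \<open>Y / n\<close>; from \<open>beta = 1\<close> on, the growth along the columns makes
  up for the initial division by \<open>n\<close>.\<close>

lemma fresh_columns_inflow_le_last:
  fixes x :: "nat \<Rightarrow> real"
  assumes "0 < n" "real n * x 0 = Y" "0 \<le> Y"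
    and "\<And>i. Suc i < n \<Longrightarrow> (real n - real (Suc i)) * x (Suc i) = (real beta + real i + 1) * x i"
    and "1 \<le> beta"
  shows "Y \<le> x (n - 1)"
proof -
  have "fact beta * fact n \<le> (fact (beta + (n - 1)) :: real)"
  proof -
    have "fact beta * fact (Suc l) \<le> (fact (beta + l) :: real)" for l
    proof (induction l)
      case (Suc l)
      have "fact beta * fact (Suc (Suc l)) = (real l + 2) * (fact beta * fact (Suc l) :: real)"
        by (simp add: algebra_simps)
      also have "\<dots> \<le> (real (beta + l) + 1) * fact (beta + l)"
        using Suc assms(5) by (intro mult_mono) auto
      finally show ?case by (simp add: algebra_simps)
    qed simp
    from this[of "n - 1"] show ?thesis using assms(1) by simp
  qed
  then have "Y * (fact beta * fact n) \<le> x (n - 1) * (fact beta * fact n)"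
    using fresh_columns_closed_form[OF assms(1,2,4), of "n - 1"] assms(1)
    by (simp add: mult_left_mono assms(3))
  then show ?thesis by simp
qed

text \<open>The recursion turns each summand into a difference: column \<open>beta + i\<close> contributes
  \<open>(beta + i + 1) x i - (n - i) x i\<close>, and \<open>(n - i) x i\<close> cancels the first part of the preceding summand.\<close>

lemma fresh_columns_moment:
  fixes x :: "nat \<Rightarrow> real"
  assumes "0 < n" "real n * x 0 = Y"
    and "\<And>i. Suc i < n \<Longrightarrow> (real n - real (Suc i)) * x (Suc i) = (real beta + real i + 1) * x i"
  shows "(\<Sum>i<n. x i * (2 * (real beta + real i) + 1 - (real beta + real n))) = (real beta + real n) * x (n - 1) - Y"
proof -
  have "(\<Sum>i<Suc l. x i * (2 * (real beta + real i) + 1 - (real beta + real n))) = (real beta + real l + 1) * x l - Y"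
    if "l < n" for l using that
  proof (induction l)
    case 0
    then show ?case using assms(2) by (simp add: algebra_simps)
  next
    case (Suc l)
    have "(real n - real (Suc l)) * x (Suc l) = (real beta + real l + 1) * x l" using assms(3) Suc.prems by simp
    then show ?case using Suc by (simp add: algebra_simps)
  qed
  from this[of "n - 1"] show ?thesis using assms(1) by (simp add: of_nat_diff)
qed


section \<open>Propagation of the inequalities\<close>

text \<open>The row of the smallest element of \<open>I\<close>, where all columns are fresh. The weighted sum is exactly zero,
  so that the bound on the real part leaves no slack; for even \<open>b\<close> the number \<open>-1\<close> is a root of
  \<open>binom(z, b) - 1\<close>.\<close>

lemma good_row_first:
  assumes b: "0 < b" and c: "\<And>j. j < b \<Longrightarrow> c j = j"
  shows "good_row b (b - 1) c (row_above b c (\<lambda>j. if j = 0 then 1 else 0))"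
proof -
  let ?e = "\<lambda>j::nat. if j = 0 then 1 else 0 :: real"
  let ?C = "row_above b c ?e"
  define x where "x = term_at_minus_one c ?C"
  have Cp: "0 < ?C (Suc j)" if "j \<le> b - 1" for j
    by (rule row_above_pos) (use that b c in auto)
  have df: "defect b c ?C j = ?e j" if "j \<le> b - 1" for j
    by (rule defect_row_above) (use that b c in auto)
  have x0: "real b * x 0 = 1" using b c[of 0] by (simp add: x_def term_at_minus_one_def basis_at_minus_one_def)
  have xS: "(real b - real (Suc i)) * x (Suc i) = (real 0 + real i + 1) * x i" if "Suc i < b" for i
    using term_at_minus_one_step[of b c ?C i] df[of "Suc i"] c[of i] c[of "Suc i"] that unfolding x_def
    by (simp del: row_above.simps)
  have 1: "\<forall>j\<le>b-1. x j \<le> x (b - 1)"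
    using fresh_columns_le_last[OF b x0 _ xS] b by simp
  have last: "real b * x (b - 1) = 1"
    using fresh_columns_closed_form[OF b x0 xS, of "b - 1"] b
    by (simp add: fact_reduce mult.commute)
  have "(\<Sum>j\<le>b-1. x j * (2 * real (c j) - real (c (b-1)))) =
     (\<Sum>i<b. x i * (2 * (real 0 + real i) + 1 - (real 0 + real b)))"
    by (rule sum.cong) (use b c in \<open>auto simp: of_nat_diff algebra_simps\<close>)
  also have "\<dots> = (real 0 + real b) * x (b - 1) - 1" by (rule fresh_columns_moment[OF b x0 xS])
  also have "\<dots> = 0" using last by simp
  finally have 2: "(\<Sum>j\<le>b-1. x j * (2 * real (c j) - real (c (b-1)))) = 0" .
  have 3: "defect b c ?C (Suc j) / ?C (Suc (Suc j)) \<le> defect b c ?C j / ?C (Suc j)" if "j < b - 1" for j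
    using df[of j] df[of "Suc j"] that Cp[of j] by (simp del: row_above.simps)
  have 4: "real b - 1 - real (c (b-1)) \<le> defect b c ?C j / ?C (Suc j)" if "j \<le> b - 1" for j
    using df[OF that] Cp[OF that] c[of "b-1"] b by (simp add: of_nat_diff del: row_above.simps)
  show ?thesis unfolding good_row_def
    using Cp 1 2 3 4 b c by (auto simp: x_def strict_mono_on_def simp del: row_above.simps(2))
qed

lemma good_row_cong:
  assumes "good_row b k c C" "\<And>j. j \<le> k \<Longrightarrow> c j = c' j"
  shows "good_row b k c' C"
proof -
  have w: "term_at_minus_one c' C j = term_at_minus_one c C j" if "j \<le> k" for j
  proof -
    have "(\<Prod>i<j. 1 + real (c' i)) = (\<Prod>i<j. 1 + real (c i))"
      by (rule prod.cong) (use assms(2) that in auto)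
    then show ?thesis by (simp add: term_at_minus_one_def basis_at_minus_one_def)
  qed
  have d: "defect b c' C j = defect b c C j" if "j \<le> k" for j
    using assms(2)[OF that] by (simp add: defect_def)
  have s: "(\<Sum>j\<le>k. term_at_minus_one c' C j * (2 * real (c' j) - real (c' k))) =
     (\<Sum>j\<le>k. term_at_minus_one c C j * (2 * real (c j) - real (c k)))"
    by (rule sum.cong) (use w assms(2) in auto)
  show ?thesis using assms(1) unfolding good_row_def s
    using w d assms(2) by (auto simp: strict_mono_on_def)
qed

text \<open>The step to the next element \<open>b' = b + 1 + n\<close> of \<open>I\<close>. If \<open>n = 0\<close>, no column is added, and everything
  follows from \<open>row_ratio\<close>. If \<open>n > 0\<close>, then \<open>c (k + n) = b' - 1\<close>, so the bound
  on the defects is trivial; but the old columns lose, since each is now compared with \<open>b' - 1\<close> in place of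
  \<open>c k\<close>. The loss is at most \<open>(b' - 1 - c k) Y\<close> with \<open>Y\<close> the weight flowing into the new columns, because
  \<open>Y = (1 + c k) x\<^sub>k\<close> is at least the sum of the \<open>k + 1\<close> old weights. The new columns gain
  \<open>b' x\<^bsub>k+n\<^esub> - Y \<ge> b' Y - Y\<close>, which is enough.\<close>

lemma good_row_next:
  assumes good: "good_row b k c C" and bb: "b' = b + 1 + n"
    and fresh: "\<And>i. i < n \<Longrightarrow> c (Suc k + i) = b + 1 + i"
    and e: "\<And>j. j \<le> k \<Longrightarrow> e j = C (Suc j)" "\<And>j. k < j \<Longrightarrow> e j = 0"
  shows "good_row b' (k + n) c (row_above b' c e)"
proof -
  let ?C = "row_above b' c e"
  have mono: "strict_mono_on {..k} c" and ckb: "c k < b" and C0: "C 0 = 0"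
    and Cp: "\<And>j. j \<le> k \<Longrightarrow> 0 < C (Suc j)"
    and sb: "\<And>j. j \<le> k \<Longrightarrow> real b - 1 - real (c k) \<le> defect b c C j / C (Suc j)"
    and wmax: "\<And>j. j \<le> k \<Longrightarrow> term_at_minus_one c C j \<le> term_at_minus_one c C k"
    and wsum: "0 \<le> (\<Sum>j\<le>k. term_at_minus_one c C j * (2 * real (c j) - real (c k)))"
    using good unfolding good_row_def by auto
  have cmono: "c i \<le> c j" if "i \<le> j" "j \<le> k" for i j
    using mono that unfolding strict_mono_on_def by (metis atMost_iff le_neq_implies_less less_imp_le order_refl le_trans)
  have cb: "c j < b" if "j \<le> k" for j using cmono[OF that order_refl] ckb by simp
  have cb': "c j < b'" if "j \<le> k + n" for j
  proof (cases "j \<le> k")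
    case True then show ?thesis using cb[of j] bb by simp
  next
    case False then show ?thesis using fresh[of "j - Suc k"] that bb by simp
  qed
  have kc: "k \<le> c k"
  proof -
    have "j \<le> k \<longrightarrow> j \<le> c j" for j
    proof (induction j)
      case (Suc j)
      then show ?case using mono unfolding strict_mono_on_def
        by (metis Suc_le_lessD atMost_iff less_imp_le lessI Suc_leI le_less_trans)
    qed simp
    then show ?thesis by blast
  qed
  have newmono: "strict_mono_on {..k + n} c"
  proof (rule strict_mono_onI)
    fix i j assume ij: "i \<in> {..k+n}" "j \<in> {..k+n}" "i < j"
    consider "j \<le> k" | "i \<le> k" "k < j" | "k < i" by linarith
    then show "c i < c j"
    proof cases
      case 1 then show ?thesis using mono ij unfolding strict_mono_on_def by auto
    next
      case 2 then show ?thesis using cb[of i] fresh[of "j - Suc k"] ij by simp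
    next
      case 3 then show ?thesis using fresh[of "j - Suc k"] fresh[of "i - Suc k"] ij by simp
    qed
  qed
  have e0: "0 \<le> e j" for j using e Cp by (cases "j \<le> k") (auto intro: less_imp_le)
  have C'p: "0 < ?C (Suc j)" if "j \<le> k + n" for j
    by (rule row_above_pos) (use that cb' e0 e Cp in auto)
  have df: "defect b' c ?C j = e j" if "j \<le> k + n" for j
    by (rule defect_row_above) (use that cb' in auto)
  define r where "r j = ?C (Suc j) / C (Suc j)" for j
  have bb': "b < b'" using bb by simp
  note ratio = row_ratio[OF good bb' e(1), folded r_def]
  have rp: "0 < r j" if "j \<le> k" for j using ratio(1)[of j] that by simp
  have rS: "r j \<le> r (Suc j)" if "j < k" for j using ratio(2)[of j] that by simp
  have rmono: "r i \<le> r j" if "i \<le> j" "j \<le> k" for i j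
    using that by (induction rule: dec_induct) (auto intro: order_trans[OF _ rS])
  have er: "e j / ?C (Suc j) = 1 / r j" if "j \<le> k" for j
    using e(1)[OF that] unfolding r_def by simp
  have slopes: "defect b' c ?C (Suc j) / ?C (Suc (Suc j)) \<le> defect b' c ?C j / ?C (Suc j)" if "j < k + n" for j
  proof (cases "j < k")
    case True
    then show ?thesis using df[of j] df[of "Suc j"] er[of j] er[of "Suc j"] rS[of j] rp[of j]
      by (simp add: frac_le del: row_above.simps)
  next
    case False
    then show ?thesis using df[of j] df[of "Suc j"] e(2)[of "Suc j"] e0[of j] C'p[of j] that
      by (simp del: row_above.simps)
  qed
  have last: "n = 0 \<or> real (c (k + n)) = real b' - 1"
    using fresh[of "n - 1"] bb by (cases n) auto
  have bound: "real b' - 1 - real (c (k + n)) \<le> defect b' c ?C j / ?C (Suc j)" if "j \<le> k + n" for j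
  proof (cases "n = 0")
    case True
    have j: "j \<le> k" using that True by simp
    have "r j * (1 + defect b c C j / C (Suc j)) \<le> 1" using ratio(1)[of j] j bb True by simp
    then have "1 + defect b c C j / C (Suc j) \<le> 1 / r j" using rp[OF j] by (simp add: field_simps)
    then show ?thesis using sb[OF j] df[OF that] er[OF j] True bb by simp
  next
    case False
    then show ?thesis using last df[OF that] e0[of j] C'p[OF that] by (simp del: row_above.simps)
  qed
  define x where "x = term_at_minus_one c ?C"
  have xr: "x j = r j * term_at_minus_one c C j" if "j \<le> k" for j
    using Cp[OF that] unfolding x_def term_at_minus_one_def r_def by simp
  have wp: "0 < term_at_minus_one c C j" if "j \<le> k" for j
    using Cp[OF that] basis_at_minus_one_pos[of c j] unfolding term_at_minus_one_def by simp
  have xk: "x j \<le> x k" if "j \<le> k" for j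
    unfolding xr[OF that] xr[OF order_refl]
    using rmono[OF that order_refl] wmax[OF that] rp[of k] wp[OF that] by (intro mult_mono) auto
  have xsum: "0 \<le> (\<Sum>j\<le>k. x j * (2 * real (c j) - real (c k)))"
  proof -
    have "0 \<le> (\<Sum>j\<le>k. r j * (term_at_minus_one c C j * (2 * real (c j) - real (c k))))"
      by (rule sum_increasing_factor_nonneg)
        (use rp wp rmono wsum cmono in \<open>auto intro: less_imp_le\<close>)
    also have "\<dots> = (\<Sum>j\<le>k. x j * (2 * real (c j) - real (c k)))"
      by (rule sum.cong) (auto simp: xr)
    finally show ?thesis .
  qed
  have goal: "(\<forall>j\<le>k+n. x j \<le> x (k+n)) \<and> 0 \<le> (\<Sum>j\<le>k+n. x j * (2 * real (c j) - real (c (k+n))))"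
  proof (cases "n = 0")
    case True then show ?thesis using xk xsum by simp
  next
    case False
    then have n: "0 < n" by simp
    define Y where "Y = (1 + real (c k)) * x k"
    define y where "y i = x (Suc k + i)" for i
    have xkp: "0 < x k" using xr[of k] rp[of k] wp[of k] by simp
    then have Y0: "0 \<le> Y" "x k \<le> Y" unfolding Y_def by (auto simp: algebra_simps)
    have hop: "(real b' - real (c (Suc j))) * x (Suc j) = (1 + real (c j)) * x j"
      if "k \<le> j" "Suc j \<le> k + n" for j
      using term_at_minus_one_step[of b' c ?C j] df[of "Suc j"] e(2)[of "Suc j"] that unfolding x_def by simp
    have y0: "real n * y 0 = Y"
      using hop[of k] n fresh[of 0] bb unfolding y_def Y_def by simp
    have yS: "(real n - real (Suc i)) * y (Suc i) = (real (b+1) + real i + 1) * y i" if "Suc i < n" for i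
      using hop[of "Suc k + i"] that fresh[of i] fresh[of "Suc i"] bb unfolding y_def
      by (simp add: algebra_simps)
    have ylast: "y (n - 1) = x (k + n)" using n unfolding y_def by simp
    have Yl: "Y \<le> x (k+n)"
      using fresh_columns_inflow_le_last[OF n y0 Y0(1) yS] ylast by simp
    have "x j \<le> x (k+n)" if "j \<le> k + n" for j
    proof (cases "j \<le> k")
      case True then show ?thesis using xk[OF True] Y0(2) Yl by simp
    next
      case False
      then show ?thesis using fresh_columns_le_last[OF n y0 Y0(1) yS, of "j - Suc k"] that ylast
        unfolding y_def by simp
    qed
    moreover have "0 \<le> (\<Sum>j\<le>k+n. x j * (2 * real (c j) - real (c (k+n))))"
    proof -
      have cl: "real (c (k+n)) = real b' - 1" using last n by simp
      \<comment> \<open>There are \<open>k + 1 \<le> 1 + c k\<close> old columns, and the last one has the largest weight.\<close>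
      have "(\<Sum>j\<le>k. x j) \<le> (\<Sum>j\<le>k. x k)" by (rule sum_mono) (use xk in auto)
      also have "\<dots> = (1 + real k) * x k" by simp
      also have "\<dots> \<le> Y" unfolding Y_def using kc xkp by (intro mult_right_mono) auto
      finally have sY: "(\<Sum>j\<le>k. x j) \<le> Y" .
      have g: "real b' - 1 - real (c k) \<ge> 0" using ckb bb by simp
      have old: "(\<Sum>j\<le>k. x j * (2 * real (c j) - real (c (k+n)))) \<ge> - (real b' - 1 - real (c k)) * Y"
      proof -
        have "(\<Sum>j\<le>k. x j * (2 * real (c j) - real (c (k+n)))) =
          (\<Sum>j\<le>k. x j * (2 * real (c j) - real (c k)) - (real b' - 1 - real (c k)) * x j)"
          by (rule sum.cong) (auto simp: cl algebra_simps)
        also have "\<dots> = (\<Sum>j\<le>k. x j * (2 * real (c j) - real (c k))) - (real b' - 1 - real (c k)) * (\<Sum>j\<le>k. x j)"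
          by (simp add: sum_subtractf sum_distrib_left)
        finally show ?thesis using xsum mult_left_mono[OF sY g] by linarith
      qed
      have "(\<Sum>i<n. x (Suc k + i) * (2 * real (c (Suc k + i)) - real (c (k+n)))) =
         (\<Sum>i<n. y i * (2 * (real (b+1) + real i) + 1 - (real (b+1) + real n)))"
        by (rule sum.cong) (use fresh bb in \<open>auto simp: y_def cl algebra_simps\<close>)
      also have "\<dots> = (real (b+1) + real n) * y (n - 1) - Y" by (rule fresh_columns_moment[OF n y0 yS])
      also have "\<dots> \<ge> real b' * Y - Y" 
      proof -
        have "real (b+1) + real n = real b'" using bb by simp
        then show ?thesis using mult_left_mono[OF Yl, of "real b'"] ylast by simp
      qed
      finally have new: "(\<Sum>i<n. x (Suc k + i) * (2 * real (c (Suc k + i)) - real (c (k+n)))) \<ge> real b' * Y - Y" .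
      have split: "(\<Sum>j\<le>k+n. f j) = (\<Sum>j\<le>k. f j) + (\<Sum>i<n. f (Suc k + i))" for f :: "nat \<Rightarrow> real"
        by (induction n) (auto simp: algebra_simps)
      have "0 \<le> real (c k) * Y" using Y0 by simp
      then show ?thesis unfolding split using old new by (simp add: algebra_simps)
    qed
    ultimately show ?thesis by blast
  qed
  show ?thesis unfolding good_row_def
    using newmono cb'[of "k+n"] C'p slopes bound goal unfolding x_def by (simp del: row_above.simps(2))
qed

section \<open>The Newton form of a descent polynomial\<close>

definition newton_form :: "nat \<Rightarrow> (nat \<Rightarrow> nat) \<Rightarrow> (nat \<Rightarrow> real) \<Rightarrow> complex \<Rightarrow> complex" where
  "newton_form k c C z = (\<Sum>j\<le>k. of_real (C (Suc j)) * (\<Prod>i<j. z - of_nat (c i)))"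

text \<open>Each \<open>C\<close> occurs in two neighbouring defects, and summation by parts collects its contributions.
  It is used with \<open>q i = z - c i\<close> for the polynomial itself and with positive real \<open>q\<close> for the comparison.\<close>

lemma sum_defect_prod:
  fixes q :: "nat \<Rightarrow> 'a::real_field"
  assumes "C 0 = 0"
  shows "(\<Sum>j\<le>k. of_real (defect a c C j) * (\<Prod>i<j. q i)) =
    of_real (C (Suc k)) * (\<Prod>i\<le>k. q i) -
    (\<Sum>j\<le>k. of_real (C (Suc j)) * (\<Prod>i<j. q i) * (q j + of_nat (c j) - of_nat a))"
proof (induction k)
  case 0
  then show ?case using assms by (simp add: defect_def algebra_simps)
next
  case (Suc k)
  show ?case
    unfolding sum.atMost_Suc Suc by (simp add: defect_def lessThan_Suc_atMost algebra_simps)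
qed

lemma newton_form_times:
  assumes "C 0 = 0"
  shows "(z - of_nat a) * newton_form k c C z =
    of_real (C (Suc k)) * (\<Prod>i\<le>k. z - of_nat (c i)) -
    (\<Sum>j\<le>k. of_real (defect a c C j) * (\<Prod>i<j. z - of_nat (c i)))"
proof -
  have "(z - of_nat a) * newton_form k c C z =
     (\<Sum>j\<le>k. of_real (C (Suc j)) * (\<Prod>i<j. z - of_nat (c i)) *
        (z - of_nat (c j) + of_nat (c j) - of_nat a))"
    unfolding newton_form_def sum_distrib_left by (rule sum.cong) auto
  then show ?thesis
    unfolding sum_defect_prod[where C = C and q = "\<lambda>i. z - of_nat (c i)", OF assms] by simp
qed

text \<open>Multiplying the new Newton form by \<open>z - b\<close> reproduces the old one with a minus sign, plus a multiple
  of \<open>z (z - 1) \<cdots> (z - b + 1)\<close>. The recursion for descent polynomials has the same shape, and the two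
  multiples agree because both polynomials vanish at \<open>z = b\<close>.\<close>

lemma newton_form_row_above:
  assumes "finite I" "\<forall>i\<in>I. i < b" "bij_betw c {..k} ({..<b} - I)"
    and d: "\<And>z. poly d z = (\<Prod>i\<in>I. z - of_nat i) * (\<Sum>j\<le>k. of_real (e j) * (\<Prod>i<j. z - of_nat (c i)))"
  shows "poly (smult (poly d (of_nat b) / fact b) (\<Prod>i<b. [:- of_nat i, 1:]) - d) z =
     (\<Prod>i\<in>insert b I. z - of_nat i) * newton_form k c (row_above b c e) z"
proof -
  let ?C = "row_above b c e"
  have bI: "b \<notin> I" using assms(2) by auto
  have cb: "c j < b" if "j \<le> k" for j using assms(3) that by (auto simp: bij_betw_def)
  have key: "(\<Prod>i\<in>insert b I. z - of_nat i) * newton_form k c ?C z =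
     of_real (?C (Suc k)) * (\<Prod>i<b. z - of_nat i) - poly d z" for z
  proof -
    have "(\<Prod>i\<le>k. z - of_nat (c i)) = (\<Prod>i\<in>{..<b} - I. z - of_nat i)"
      using prod.reindex_bij_betw[OF assms(3)] .
    moreover have "(\<Prod>i\<in>I. z - of_nat i) * (\<Prod>i\<in>{..<b} - I. z - of_nat i) = (\<Prod>i<b. z - of_nat i)"
      using assms(2) by (subst mult.commute, intro prod.subset_diff[symmetric]) auto
    ultimately have P: "(\<Prod>i\<in>I. z - of_nat i) * (\<Prod>i\<le>k. z - of_nat (c i)) = (\<Prod>i<b. z - of_nat i)" by simp
    have E: "(z - of_nat b) * newton_form k c ?C z = of_real (?C (Suc k)) * (\<Prod>i\<le>k. z - of_nat (c i)) -
       (\<Sum>j\<le>k. of_real (e j) * (\<Prod>i<j. z - of_nat (c i)))"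
      using newton_form_times[of ?C z b k c] cb by (simp add: defect_row_above del: row_above.simps(2))
    have "(\<Prod>i\<in>I. z - of_nat i) * ((z - of_nat b) * newton_form k c ?C z) =
       of_real (?C (Suc k)) * ((\<Prod>i\<in>I. z - of_nat i) * (\<Prod>i\<le>k. z - of_nat (c i))) - poly d z"
      unfolding d E by (simp add: algebra_simps del: row_above.simps)
    then show ?thesis unfolding P using bI assms(1) by (simp add: ac_simps del: row_above.simps)
  qed
  have "(\<Prod>i<b. of_nat b - of_nat i :: complex) = fact b"
    using gbinomial_prod_rev[of "of_nat b :: complex" b] binomial_gbinomial[of b b, where 'a = complex]
    by (simp add: atLeast0LessThan)
  moreover have "(\<Prod>i\<in>insert b I. of_nat b - of_nat i :: complex) = 0"
    using assms(1) bI by simp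
  ultimately have "of_real (?C (Suc k)) * fact b = poly d (of_nat b)"
    using key[of "of_nat b"] by (simp del: row_above.simps)
  then have "poly d (of_nat b) / fact b = of_real (?C (Suc k))" by (metis fact_nonzero nonzero_mult_div_cancel_right)
  then show ?thesis unfolding key by (simp add: poly_prod del: row_above.simps)
qed

text \<open>The induction adds the elements of \<open>I\<close> in increasing order. From \<open>a = Max I\<close> to the next element \<open>b\<close> the
  columns \<open>a + 1, \<dots>, b - 1\<close> are appended, with coefficient zero in the row of \<open>a\<close>. The existence of the
  descent polynomial comes out of the same induction.\<close>

lemma descent_poly_newton_form:
  assumes "finite I" "\<forall>i\<in>I. 0 < i" "I \<noteq> {}"
  shows "\<exists>k c C. good_row (Max I) k c C \<and> bij_betw c {..k} ({..<Max I} - I) \<and> is_descent_poly I (descent_poly I) \<and>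
     (\<forall>z. poly (descent_poly I) z = (\<Prod>i\<in>I. z - of_nat i) * newton_form k c C z)"
  using assms
proof (induction I rule: finite_linorder_max_induct)
  case empty
  then show ?case by simp
next
  case (insert b I)
  have b: "0 < b" using insert.prems by simp
  have Mx: "Max (insert b I) = b" using insert.hyps by (intro Max_eqI) (auto intro: less_imp_le)
  let ?d = "descent_poly I"
  let ?d' = "smult (poly ?d (of_nat b) / fact b) (\<Prod>i<b. [:- of_nat i, 1:]) - ?d"
  have "\<exists>k c e. good_row b k c (row_above b c e) \<and> bij_betw c {..k} ({..<b} - I) \<and> is_descent_poly I ?d \<and>
     (\<forall>z. poly ?d z = (\<Prod>i\<in>I. z - of_nat i) * (\<Sum>j\<le>k. of_real (e j) * (\<Prod>i<j. z - of_nat (c i))))"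
  proof (cases "I = {}")
    case True
    have d: "?d = 1" "is_descent_poly I ?d"
      using is_descent_poly_empty descent_poly_eqI True by auto
    have 1: "good_row b (b - 1) id (row_above b id (\<lambda>j. if j = 0 then 1 else 0))"
      by (rule good_row_first) (use b in auto)
    have "{..b - 1} = {..<b}" using b by auto
    then have 2: "bij_betw id {..b-1} ({..<b} - I)" using True by (simp add: bij_betw_def)
    have "(\<Sum>j\<le>b-1. of_real (if j = 0 then 1 else 0) * (\<Prod>i<j. z - of_nat (id i))) = (1::complex)" for z
    proof -
      have "(\<Sum>j\<le>b-1. of_real (if j = 0 then 1 else 0) * (\<Prod>i<j. z - of_nat (id i))) =
         (\<Sum>j\<le>b-1. if j = 0 then 1 else (0::complex))" by (rule sum.cong) auto
      then show ?thesis by simp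
    qed
    then have "\<forall>z. poly ?d z = (\<Prod>i\<in>I. z - of_nat i) *
       (\<Sum>j\<le>b-1. of_real (if j = 0 then 1 else 0) * (\<Prod>i<j. z - of_nat (id i)))"
      using d True by simp
    then show ?thesis using 1 2 d(2)
      by (intro exI[of _ "b - 1"] exI[of _ id] exI[of _ "\<lambda>j. if j = 0 then 1 else 0"] conjI)
  next
    case False
    define a where "a = Max I"
    have ab: "a < b" "a \<in> I" using insert.hyps False unfolding a_def by auto
    define n where "n = b - a - 1"
    obtain k c C where IH: "good_row a k c C" "bij_betw c {..k} ({..<a} - I)" "is_descent_poly I ?d"
      "\<And>z. poly ?d z = (\<Prod>i\<in>I. z - of_nat i) * newton_form k c C z"
      using insert.IH insert.prems False unfolding a_def by auto
    define c' where "c' j = (if j \<le> k then c j else a + 1 + (j - Suc k))" for j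
    define e where "e j = (if j \<le> k then C (Suc j) else 0)" for j
    have gc: "good_row a k c' C" using IH(1) by (rule good_row_cong) (simp add: c'_def)
    have g: "good_row b (k + n) c' (row_above b c' e)"
      using gc by (rule good_row_next) (use ab in \<open>auto simp: n_def c'_def e_def\<close>)
    have bij: "bij_betw c' {..k+n} ({..<b} - I)"
    proof -
      have Ia: "i \<le> a" if "i \<in> I" for i using that insert.hyps unfolding a_def by simp
      have b1: "bij_betw c' {..k} ({..<a} - I)"
        using IH(2) by (rule bij_betw_cong[THEN iffD1, rotated]) (simp add: c'_def)
      have b2: "bij_betw c' {k<..k+n} {a<..<b}"
        by (rule bij_betwI[where g = "\<lambda>i. i - (a + 1) + Suc k"]) (use ab in \<open>auto simp: c'_def n_def\<close>)
      have "bij_betw c' ({..k} \<union> {k<..k+n}) (({..<a} - I) \<union> {a<..<b})"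
        by (rule bij_betw_combine[OF b1 b2]) auto
      moreover have "{..k} \<union> {k<..k+n} = {..k+n}" by auto
      moreover have "({..<a} - I) \<union> {a<..<b} = {..<b} - I"
      proof (rule set_eqI)
        fix x show "x \<in> ({..<a} - I) \<union> {a<..<b} \<longleftrightarrow> x \<in> {..<b} - I"
          using ab Ia[of x] by (cases "x = a") auto
      qed
      ultimately show ?thesis by simp
    qed
    have "newton_form k c C z = (\<Sum>j\<le>k+n. of_real (e j) * (\<Prod>i<j. z - of_nat (c' i)))" for z
    proof -
      have "newton_form k c C z = (\<Sum>j\<le>k. of_real (e j) * (\<Prod>i<j. z - of_nat (c' i)))"
        unfolding newton_form_def by (rule sum.cong) (auto simp: e_def c'_def intro!: prod.cong)
      also have "\<dots> = (\<Sum>j\<le>k+n. of_real (e j) * (\<Prod>i<j. z - of_nat (c' i)))"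
        by (rule sum.mono_neutral_left) (auto simp: e_def)
      finally show ?thesis .
    qed
    then have "\<forall>z. poly ?d z = (\<Prod>i\<in>I. z - of_nat i) *
       (\<Sum>j\<le>k+n. of_real (e j) * (\<Prod>i<j. z - of_nat (c' i)))"
      using IH(4) by simp
    then show ?thesis using g bij IH(3)
      by (intro exI[of _ "k + n"] exI[of _ c'] exI[of _ e] conjI)
  qed
  then obtain k c e where row: "good_row b k c (row_above b c e)" "bij_betw c {..k} ({..<b} - I)"
      "is_descent_poly I ?d"
    "\<forall>z. poly ?d z = (\<Prod>i\<in>I. z - of_nat i) * (\<Sum>j\<le>k. of_real (e j) * (\<Prod>i<j. z - of_nat (c i)))"
    by (elim exE conjE) (rule that)
  have D: "is_descent_poly (insert b I) ?d'"
    using insert row(3) b by (intro is_descent_poly_insert) auto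
  have "descent_poly (insert b I) = ?d'" using D by (rule descent_poly_eqI)
  moreover have "poly ?d' z = (\<Prod>i\<in>insert b I. z - of_nat i) * newton_form k c (row_above b c e) z" for z
    using newton_form_row_above[OF insert.hyps(1,2) row(2) row(4)[rule_format]] .
  moreover have "{..<b} - insert b I = {..<b} - I" by auto
  ultimately show ?case unfolding Mx using row(1,2) D by (intro exI[of _ k] exI[of _ c] exI[of _ "row_above b c e"]) auto
qed

section \<open>Regions without roots\<close>

text \<open>At a zero, the leading term of \<open>(z - a) Q(z)\<close> would equal the sum of the others. Divided by the
  product of all \<open>\<bar>z - c i\<bar>\<close>, the leading term is constant, while every other term is smaller in modulus
  than with \<open>q i\<close> in place of \<open>z - c i\<close>, strictly so for \<open>j = 0\<close>.\<close>

lemma newton_form_nonzero: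
  assumes C: "C 0 = 0" "\<And>j. j \<le> k \<Longrightarrow> 0 < C (Suc j)"
    and D: "\<And>j. j \<le> k \<Longrightarrow> 0 \<le> defect a c C j" and a: "c 0 < a"
    and q: "\<And>j. j \<le> k \<Longrightarrow> 0 < q j" "\<And>j. j \<le> k \<Longrightarrow> q j < cmod (z - of_nat (c j))"
    and bal: "(\<Sum>j\<le>k. defect a c C j * (\<Prod>i<j. q i)) \<le> C (Suc k) * (\<Prod>i\<le>k. q i)"
  shows "newton_form k c C z \<noteq> 0"
proof
  assume zero: "newton_form k c C z = 0"
  define P where "P j = (\<Prod>i<j. cmod (z - of_nat (c i)))" for j
  define R where "R j = (\<Prod>i<j. q i)" for j
  have "0 < cmod (z - of_nat (c j))" if "j \<le> k" for j
    using q[OF that] by (rule less_trans)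
  then have Pp: "0 < P j" if "j \<le> Suc k" for j
    unfolding P_def by (intro prod_pos) (use that in auto)
  have Rp: "0 < R j" if "j \<le> Suc k" for j
    unfolding R_def by (intro prod_pos) (use that q in auto)
  have "of_real (C (Suc k)) * (\<Prod>i\<le>k. z - of_nat (c i)) =
      (\<Sum>j\<le>k. of_real (defect a c C j) * (\<Prod>i<j. z - of_nat (c i)))"
    using newton_form_times[where C = C, OF C(1), of z a k c] zero by simp
  then have "cmod (of_real (C (Suc k)) * (\<Prod>i\<le>k. z - of_nat (c i))) \<le>
     (\<Sum>j\<le>k. cmod (of_real (defect a c C j) * (\<Prod>i<j. z - of_nat (c i))))"
    by (metis norm_sum)
  then have le: "C (Suc k) * P (Suc k) \<le> (\<Sum>j\<le>k. defect a c C j * P j)"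
    using D C(2)[of k] by (simp add: norm_mult prod_norm P_def lessThan_Suc_atMost[symmetric] abs_of_pos del: lessThan_Suc)
  have cross: "P j * R (Suc k) \<le> R j * P (Suc k)" if "j \<le> Suc k" for j
    using that
  proof (induction rule: inc_induct)
    case (step j)
    have "P j * R (Suc k) * q j \<le> P j * R (Suc k) * cmod (z - of_nat (c j))"
      using q[of j] Pp[of j] Rp[of "Suc k"] step by (intro mult_left_mono) auto
    also have "\<dots> = P (Suc j) * R (Suc k)" by (simp add: P_def)
    also have "\<dots> \<le> R (Suc j) * P (Suc k)" by (rule step.IH)
    also have "\<dots> = R j * P (Suc k) * q j" by (simp add: R_def)
    finally show ?case using q(1)[of j] step by simp
  qed simp
  have strict: "P 0 * R (Suc k) < R 0 * P (Suc k)"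
  proof -
    have "P 0 * R (Suc k) * q 0 < P 0 * R (Suc k) * cmod (z - of_nat (c 0))"
      using q[of 0] Pp[of 0] Rp[of "Suc k"] by simp
    also have "\<dots> = P (Suc 0) * R (Suc k)" by (simp add: P_def)
    also have "\<dots> \<le> R (Suc 0) * P (Suc k)" by (rule cross) simp
    also have "\<dots> = R 0 * P (Suc k) * q 0" by (simp add: R_def)
    finally show ?thesis using q(1)[of 0] by simp
  qed
  have D0: "0 < defect a c C 0" using C(1) C(2)[of 0] a by (simp add: defect_def)
  have "C (Suc k) * P (Suc k) * R (Suc k) \<le> (\<Sum>j\<le>k. defect a c C j * P j) * R (Suc k)"
    using le Rp[of "Suc k"] by simp
  also have "\<dots> = (\<Sum>j\<le>k. defect a c C j * (P j * R (Suc k)))" by (simp add: sum_distrib_right mult.assoc)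
  also have "\<dots> < (\<Sum>j\<le>k. defect a c C j * (R j * P (Suc k)))"
  proof (rule sum_strict_mono_ex1)
    show "\<forall>j\<in>{..k}. defect a c C j * (P j * R (Suc k)) \<le> defect a c C j * (R j * P (Suc k))"
      using cross D by (auto intro!: mult_left_mono)
    show "\<exists>j\<in>{..k}. defect a c C j * (P j * R (Suc k)) < defect a c C j * (R j * P (Suc k))"
      using strict D0 by (intro bexI[of _ 0]) auto
  qed simp
  also have "\<dots> = (\<Sum>j\<le>k. defect a c C j * R j) * P (Suc k)" by (simp add: sum_distrib_right mult.assoc)
  also have "\<dots> \<le> C (Suc k) * R (Suc k) * P (Suc k)"
    using bal Pp[of "Suc k"] by (intro mult_right_mono) (auto simp: R_def lessThan_Suc_atMost)
  finally show False by (simp add: mult.commute mult.left_commute)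
qed

theorem theorem1p1:
  fixes I :: "nat set" and m :: nat and z0 :: complex
  assumes "finite I" and "\<forall>i\<in>I. i > 0"
    and "m = Max (I \<union> {0})"
    and "poly (descent_poly I) z0 = 0"
  shows "cmod z0 \<le> real m \<and> Re z0 \<ge> -1"
proof (cases "I = {}")
  case True
  then have "descent_poly I = 1" using is_descent_poly_empty descent_poly_eqI by blast
  then show ?thesis using assms(4) by simp
next
  case False
  have m: "m = Max I" using assms(1,3) False by simp
  obtain k c C where good: "good_row m k c C" and bij: "bij_betw c {..k} ({..<m} - I)"
    and d: "\<And>z. poly (descent_poly I) z = (\<Prod>i\<in>I. z - of_nat i) * newton_form k c C z"
    using descent_poly_newton_form[OF assms(1,2) False] unfolding m by blast
  have mono: "strict_mono_on {..k} c" and C0: "C 0 = 0"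
    and Cp: "\<And>j. j \<le> k \<Longrightarrow> 0 < C (Suc j)"
    and sb: "\<And>j. j \<le> k \<Longrightarrow> real m - 1 - real (c k) \<le> defect m c C j / C (Suc j)"
    and wsum: "0 \<le> (\<Sum>j\<le>k. term_at_minus_one c C j * (2 * real (c j) - real (c k)))"
    using good unfolding good_row_def by auto
  have cm: "c j < m" if "j \<le> k" for j using bij that by (auto simp: bij_betw_def)
  have ck: "c 0 \<le> c k" using mono unfolding strict_mono_on_def
    by (metis atMost_iff le0 le_neq_implies_less less_imp_le order_refl)
  have iz: "(\<exists>i\<in>I. z0 = of_nat i) \<or> newton_form k c C z0 = 0"
    using d[of z0] assms(1,4) by auto
  have "cmod z0 \<le> real m"
  proof (rule ccontr)
    assume "\<not> cmod z0 \<le> real m"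
    then have big: "real m < cmod z0" by simp
    have "newton_form k c C z0 \<noteq> 0"
    proof (rule newton_form_nonzero[where a = m and q = "\<lambda>j. real m - real (c j)"])
      show "0 \<le> defect m c C j" if "j \<le> k" for j
      proof -
        have "0 \<le> defect m c C j / C (Suc j)" using sb[OF that] cm[of k] by simp
        then show ?thesis using Cp[OF that] by (simp add: zero_le_divide_iff)
      qed
      show "real m - real (c j) < cmod (z0 - of_nat (c j))" if "j \<le> k" for j
        using norm_triangle_ineq2[of z0 "of_nat (c j)"] big by simp
      show "(\<Sum>j\<le>k. defect m c C j * (\<Prod>i<j. real m - real (c i))) \<le> C (Suc k) * (\<Prod>i\<le>k. real m - real (c i))"
        using sum_defect_prod[where C = C and q = "\<lambda>j. real m - real (c j)", OF C0, of m c k] by simp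
    qed (use C0 Cp cm in auto)
    moreover have "z0 \<noteq> of_nat i" if "i \<in> I" for i
      using big Max_ge[OF assms(1) that] m by auto
    ultimately show False using iz by blast
  qed
  moreover have "Re z0 \<ge> -1"
  proof (rule ccontr)
    assume "\<not> Re z0 \<ge> -1"
    then have left: "Re z0 < -1" by simp
    \<comment> \<open>Here \<open>a = m\<close> would not do: for \<open>I = {2, 3}\<close> the comparison fails with it.\<close>
    let ?a = "Suc (c k)"
    have "newton_form k c C z0 \<noteq> 0"
    proof (rule newton_form_nonzero[where a = ?a and q = "\<lambda>j. 1 + real (c j)"])
      show "0 \<le> defect ?a c C j" if "j \<le> k" for j
      proof -
        have "(real m - 1 - real (c k)) * C (Suc j) \<le> defect m c C j"
          using sb[OF that] Cp[OF that] by (simp add: le_divide_eq)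
        then show ?thesis by (simp add: defect_def algebra_simps)
      qed
      show "1 + real (c j) < cmod (z0 - of_nat (c j))" if "j \<le> k" for j
        using abs_Re_le_cmod[of "z0 - of_nat (c j)"] left by simp
      have "(\<Sum>j\<le>k. C (Suc j) * (\<Prod>i<j. 1 + real (c i)) * (1 + real (c j) + real (c j) - real ?a)) =
         (\<Sum>j\<le>k. term_at_minus_one c C j * (2 * real (c j) - real (c k)))"
        by (rule sum.cong) (auto simp: term_at_minus_one_def basis_at_minus_one_def)
      then show "(\<Sum>j\<le>k. defect ?a c C j * (\<Prod>i<j. 1 + real (c i))) \<le> C (Suc k) * (\<Prod>i\<le>k. 1 + real (c i))"
        using wsum
          sum_defect_prod[where C = C and q = "\<lambda>j. 1 + real (c j)", OF C0, of ?a c k] by simp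
    qed (use C0 Cp ck in \<open>auto simp: add_pos_nonneg\<close>)
    moreover have "z0 \<noteq> of_nat i" for i using left by auto
    ultimately show False using iz by blast
  qed
  ultimately show ?thesis ..
qed

end
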